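(* For any integer $n\ge2$ and any distribution $p$ over $\mathbb Z$, if $p$ is log-concave and has variance $\sigma^2$, then \[ H^{\mathcal S}_n(p)\le\mathcal O(\log n)\left(1+\min\left\{\sigma,\frac n\sigma\right\}\right). \]
   Context: A distribution $p$ over $\mathbb Z$ is log-concave if it has a contiguous support (its support is a set of consecutive integers) and $p_x^2\ge p_{x-1}p_{x+1}$ for all $x\in\mathbb Z$. For integers $j\ge1$ let $I_j:=\left((j-1)^2\frac{\log n}{n},\ j^2\frac{\log n}{n}\right]$, let $p_{I_j}$ be the number of symbols $x\in\mathbb Z$ with $p_x\in I_j$, and define $H^{\mathcal S}_n(p):=\sum_{j\ge1}\min\{p_{I_j},\ j\cdot\log n\}$. $\log$ is the natural logarithm; $\sigma\ge0$, with $n/\sigma=+\infty$ if $\sigma=0$. $\mathcal O$ hides an absolute constant. *)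

theory Defs
  imports "HOL-Probability.Probability"
begin

definition contiguous :: "int set \<Rightarrow> bool" where
  "contiguous S \<longleftrightarrow> (\<forall>x\<in>S. \<forall>z\<in>S. {x..z} \<subseteq> S)"

definition log_concave :: "int pmf \<Rightarrow> bool" where
  "log_concave p \<longleftrightarrow>
     contiguous (set_pmf p) \<and> (\<forall>x. pmf p (x - 1) * pmf p (x + 1) \<le> (pmf p x)\<^sup>2)"

(* The Bochner integral of a non-integrable function is 0, so the existence of the
   second moment is stated explicitly. *)
definition has_variance :: "int pmf \<Rightarrow> real \<Rightarrow> bool" where
  "has_variance p v \<longleftrightarrow>
     integrable (measure_pmf p) (\<lambda>x. (real_of_int x)\<^sup>2) \<and>
     measure_pmf.variance p real_of_int = v"

definition prob_interval :: "nat \<Rightarrow> nat \<Rightarrow> real set" where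
  "prob_interval n j =
     {(real j - 1)\<^sup>2 * (ln (real n) / real n) <.. (real j)\<^sup>2 * (ln (real n) / real n)}"

(* The number of symbols is counted in the extended nonnegative reals, since the
   interval with j = 1 contains infinitely many of the probabilities whenever p has
   infinite support, whereas card would return 0 there. *)
definition num_symbols :: "int pmf \<Rightarrow> real set \<Rightarrow> ennreal" where
  "num_symbols p I = emeasure (count_space UNIV) {x. pmf p x \<in> I}"

definition H\<^sub>S :: "nat \<Rightarrow> int pmf \<Rightarrow> ennreal" where
  "H\<^sub>S n p =
     (\<Sum>\<^sub>\<infinity>j\<in>{1..}. min (num_symbols p (prob_interval n j)) (ennreal (real j * ln (real n))))"

end

theory Submission imports Defs begin

text \<open>Let \<open>m\<close> be a mode of \<open>p\<close>, \<open>M = p\<^sub>m\<close> and \<open>d = \<lceil>2/M\<rceil>\<close>. Fewer than \<open>d\<close> consecutive symbols can have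
  probability above \<open>M/2\<close>, so by log-concavity the probabilities halve with every \<open>d\<close> steps away from
  \<open>m\<close>. Hence the second moment around \<open>m\<close> is at most a constant times \<open>d\<^sup>2\<close>, which gives \<open>\<sigma> = O(1/M)\<close>,
  while Chebyshev's inequality gives \<open>1/M = O(1 + \<sigma>)\<close>. By the geometric decay only \<open>O(d log n)\<close>
  symbols have probability above \<open>log n / n\<close>, which yields the bound by \<open>\<sigma>\<close>. For the bound by
  \<open>n/\<sigma>\<close>, only the indices \<open>j \<le> 1 + sqrt (M n / log n)\<close> contribute, and the caps \<open>j log n\<close> of
  those sum to \<open>O(log n + M n)\<close>.\<close>

section \<open>Real sequences: log-concavity and geometric decay\<close>

lemma iterated_halving:
  fixes f :: "nat \<Rightarrow> real"
  assumes "\<And>i. f (i+d) \<le> f i / 2"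
  shows "f (k*d+i) \<le> f i / 2^k"
proof (induction k)
  case (Suc k)
  have "f (Suc k * d + i) \<le> f (k*d+i) / 2" using assms[of "k*d+i"] by (simp add: algebra_simps)
  also have "\<dots> \<le> (f i / 2^k) / 2" using Suc by (intro divide_right_mono) auto
  finally show ?case by (simp add: mult.commute)
qed simp

text \<open>The ratios \<open>f (Suc i) / f i\<close> are nonincreasing, so \<open>d\<close> steps
  from \<open>i\<close> shrink \<open>f\<close> by at least the factor for \<open>d\<close> steps
  from \<open>0\<close>. Everything is cross-multiplied to admit zeros. The hypothesis
  \<open>nz\<close> excludes internal zeros, as in 1, 0, 0, 1, where the claim fails.\<close>

lemma log_concave_seq_mult_le:
  fixes f :: "nat \<Rightarrow> real"
  assumes nn: "\<And>i. 0 \<le> f i"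
    and nz: "\<And>i. f i = 0 \<Longrightarrow> f (Suc i) = 0"
    and lc: "\<And>i. f i * f (i+2) \<le> (f (Suc i))^2"
  shows "f (i+d) * f 0 \<le> f i * f d"
proof -
  have ratio: "f (Suc (i+j)) * f i \<le> f (i+j) * f (Suc i)" for i j
  proof (induction j)
    case (Suc j)
    show ?case
    proof (cases "f (i+j) = 0")
      case True
      hence "f (Suc (Suc (i+j))) = 0" using nz by blast
      thus ?thesis using nn by simp
    next
      case False
      hence p: "f (i+j) > 0" using nn[of "i+j"] by simp
      have "f (i+j) * (f (Suc (i + Suc j)) * f i) \<le> (f (Suc (i+j)))^2 * f i"
        using mult_right_mono[OF lc[of "i+j"] nn[of i]] by (simp add: mult_ac)
      also have "\<dots> \<le> f (Suc (i+j)) * (f (i+j) * f (Suc i))"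
        using mult_left_mono[OF Suc nn[of "Suc (i+j)"]] by (simp add: power2_eq_square mult_ac)
      finally have "f (i+j) * (f (Suc (i + Suc j)) * f i) \<le> f (i+j) * (f (i + Suc j) * f (Suc i))"
        by (simp add: mult_ac)
      thus ?thesis using p by simp
    qed
  qed simp
  show ?thesis
  proof (induction i)
    case (Suc i)
    show ?case
    proof (cases "f i = 0")
      case True
      hence "f (i + k) = 0" for k by (induction k) (use nz in auto)
      from this[of "Suc d"] have "f (Suc i + d) = 0" by simp
      thus ?thesis using nn by simp
    next
      case False
      hence p: "f i > 0" using nn[of i] by simp
      have "f i * (f (Suc i + d) * f 0) \<le> f (i+d) * f (Suc i) * f 0"
        using mult_right_mono[OF ratio[of i d] nn[of 0]] by (simp add: mult_ac)
      also have "\<dots> \<le> f i * f d * f (Suc i)"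
        using mult_right_mono[OF Suc nn[of "Suc i"]] by (simp add: mult_ac)
      finally have "f i * (f (Suc i + d) * f 0) \<le> f i * (f (Suc i) * f d)" by (simp add: mult_ac)
      thus ?thesis using p by simp
    qed
  qed simp
qed

text \<open>Splitting off the first \<open>d\<close> terms and halving the shifted rest bounds the sum \<open>S\<close> by
  itself, \<open>S \<le> 3/4 S + 5/2 d\<^sup>2\<close>, so no geometric series is needed.\<close>

lemma second_moment_le:
  fixes f :: "nat \<Rightarrow> real"
  assumes nn: "\<And>i. 0 \<le> f i" and half: "\<And>i. f (i+d) \<le> f i / 2"
    and le1: "\<And>N. (\<Sum>i<N. f i) \<le> 1"
  shows "(\<Sum>i<N. (real i)^2 * f i) \<le> 10 * (real d)^2"
proof -
  define S where "S = (\<Sum>i<N. (real i)^2 * f i)"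
  have "S \<le> (\<Sum>i<d+N. (real i)^2 * f i)"
    unfolding S_def by (rule sum_mono2) (auto simp: nn)
  also have "\<dots> = (\<Sum>i<d. (real i)^2 * f i) + (\<Sum>i<N. (real (i+d))^2 * f (i+d))"
    by (induction N) (simp_all add: add.commute)
  also have "(\<Sum>i<d. (real i)^2 * f i) \<le> (\<Sum>i<d. (real d)^2 * f i)"
    by (intro sum_mono mult_right_mono power_mono nn) auto
  also have "\<dots> = (real d)^2 * (\<Sum>i<d. f i)" by (simp add: sum_distrib_left)
  also have "\<dots> \<le> (real d)^2 * 1" by (intro mult_left_mono le1) simp
  also have "(\<Sum>i<N. (real (i+d))^2 * f (i+d)) \<le> (\<Sum>i<N. 3/4 * ((real i)^2 * f i) + 3/2 * (real d)^2 * f i)"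
  proof (rule sum_mono)
    fix i
    \<comment> \<open>The cross term is split unevenly: the coefficient of \<open>i^2\<close> must
      stay below 2, so that after halving it is below 1 and \<open>S\<close> can be
      absorbed.\<close>
    have "0 \<le> (real i - 2 * real d)^2" by simp
    hence a: "(real (i+d))^2 \<le> 3/2 * (real i)^2 + 3 * (real d)^2"
      by (simp add: power2_eq_square algebra_simps)
    have "(real (i+d))^2 * f (i+d) \<le> (3/2 * (real i)^2 + 3 * (real d)^2) * (f i / 2)"
      by (rule mult_mono[OF a half]) (use nn in auto)
    thus "(real (i+d))^2 * f (i+d) \<le> 3/4 * ((real i)^2 * f i) + 3/2 * (real d)^2 * f i"
      by (simp add: algebra_simps)
  qed
  also have "\<dots> = 3/4 * S + 3/2 * (real d)^2 * (\<Sum>i<N. f i)"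
    by (simp add: S_def sum.distrib sum_distrib_left)
  also have "\<dots> \<le> 3/4 * S + 3/2 * (real d)^2 * 1"
    by (intro add_left_mono mult_left_mono le1) simp
  finally show ?thesis unfolding S_def by simp
qed

section \<open>Existence of a mode\<close>

lemma sum_pmf_le_1: "finite F \<Longrightarrow> (\<Sum>x\<in>F. pmf p x) \<le> 1"
  by (simp flip: measure_measure_pmf_finite)

lemma sum_pmf_inj_le_1:
  assumes "inj_on g F" "finite F"
  shows "(\<Sum>i\<in>F. pmf p (g i)) \<le> 1"
  using sum_pmf_le_1[of "g ` F" p] assms by (simp add: sum.reindex)

lemma finite_pmf_ge:
  assumes "0 < e"
  shows "finite {x. e \<le> pmf p x}"
proof (rule ccontr)
  assume "infinite {x. e \<le> pmf p x}"
  then obtain F where F: "F \<subseteq> {x. e \<le> pmf p x}" "finite F" "card F = Suc (nat \<lceil>1 / e\<rceil>)"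
    using infinite_arbitrarily_large by blast
  have "1 / e < real (card F)" using F(3) by linarith
  hence "1 < real (card F) * e" using assms by (simp add: field_simps)
  also have "\<dots> = (\<Sum>x\<in>F. e)" by simp
  also have "\<dots> \<le> (\<Sum>x\<in>F. pmf p x)" using F(1) by (intro sum_mono) auto
  also have "\<dots> \<le> 1" using F(2) by (rule sum_pmf_le_1)
  finally show False by simp
qed

text \<open>Only finitely many symbols are at least as probable as a fixed support point
  \<open>a\<close>, so the maximum is attained even on an infinite support.\<close>

lemma pmf_mode: "\<exists>m. 0 < pmf p m \<and> (\<forall>x. pmf p x \<le> pmf p m)"
proof -
  obtain a where a: "a \<in> set_pmf p" using set_pmf_not_empty[of p] by blast
  define A where "A = {x. pmf p a \<le> pmf p x}"
  have "0 < pmf p a" using a by (simp add: pmf_positive)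
  hence "finite A" unfolding A_def by (rule finite_pmf_ge)
  moreover have "a \<in> A" by (simp add: A_def)
  ultimately have "Max (pmf p ` A) \<in> pmf p ` A" "\<forall>x\<in>A. pmf p x \<le> Max (pmf p ` A)"
    by (auto intro!: Max_in)
  then obtain m where m: "m \<in> A" "\<forall>x\<in>A. pmf p x \<le> pmf p m" by auto
  have "pmf p x \<le> pmf p m" for x
    using m by (cases "x \<in> A") (auto simp: A_def)
  moreover have "0 < pmf p m" using m(1) \<open>0 < pmf p a\<close> by (simp add: A_def)
  ultimately show ?thesis by blast
qed

section \<open>Decay away from the mode\<close>

definition half_width :: "'a pmf \<Rightarrow> 'a \<Rightarrow> nat" where
  "half_width p m = nat \<lceil>2 / pmf p m\<rceil>"

text \<open>Rounding up adds at most 1 to \<open>2 / pmf p m\<close>, and \<open>pmf p m\<close> is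
  at most 1. This lets the half-width stand for a multiple of \<open>1 / pmf p m\<close>.\<close>

lemma half_width_le:
  assumes "0 < pmf p m"
  shows "real (half_width p m) * pmf p m \<le> 3"
proof -
  have "0 < 2 / pmf p m" using assms by simp
  hence "real (half_width p m) \<le> 2 / pmf p m + 1" unfolding half_width_def by linarith
  hence "real (half_width p m) * pmf p m \<le> (2 / pmf p m + 1) * pmf p m"
    using assms by (intro mult_right_mono) auto
  also have "\<dots> = 2 + pmf p m" using assms by (simp add: field_simps)
  finally show ?thesis using pmf_le_1[of p m] by linarith
qed

text \<open>The sign \<open>s\<close> selects the right or the left tail.\<close>

lemma log_concave_halving:
  fixes s :: int
  assumes lc: "log_concave p" and m: "0 < pmf p m" "\<And>x. pmf p x \<le> pmf p m"
    and s: "s = 1 \<or> s = -1"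
  defines "f \<equiv> \<lambda>i::nat. pmf p (m + s * int i)"
  shows "f (i + half_width p m) \<le> f i / 2"
proof -
  let ?d = "half_width p m"
  have nn: "0 \<le> f i" for i by (simp add: f_def)
  have f0: "f 0 = pmf p m" by (simp add: f_def)
  have lcf: "f i * f (i+2) \<le> (f (Suc i))^2" for i
    using lc[unfolded log_concave_def, THEN conjunct2, rule_format, of "m + s * int (Suc i)"] s
    by (auto simp: f_def algebra_simps)
  \<comment> \<open>Position \<open>i\<close> lies between the mode and position
    \<open>Suc i\<close>, so contiguity of the support would make \<open>f i\<close>
    positive.\<close>
  have nz: "f (Suc i) = 0" if "f i = 0" for i
  proof (rule ccontr)
    assume "f (Suc i) \<noteq> 0"
    hence 1: "m + s * int (Suc i) \<in> set_pmf p" by (simp add: f_def set_pmf_iff)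
    have 2: "m \<in> set_pmf p" using m(1) by (simp add: set_pmf_iff)
    have c: "contiguous (set_pmf p)" using lc by (simp add: log_concave_def)
    have "m + s * int i \<in> set_pmf p"
    proof (cases "s = 1")
      case True
      hence "m + s * int i \<in> {m..m + s * int (Suc i)}" by simp
      thus ?thesis using c 1 2 unfolding contiguous_def by blast
    next
      case False
      hence "m + s * int i \<in> {m + s * int (Suc i)..m}" using s by auto
      thus ?thesis using c 1 2 unfolding contiguous_def by blast
    qed
    thus False using that by (simp add: f_def set_pmf_iff)
  qed
  have sub: "f (i + j) * f 0 \<le> f i * f j" for i j
    by (rule log_concave_seq_mult_le[OF nn nz lcf])
  have anti: "f (i + j) \<le> f i" for i j
  proof -
    have "f i * f j \<le> f i * f 0" using m(2) nn by (intro mult_left_mono) (auto simp: f_def)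
    hence "f (i + j) * f 0 \<le> f i * f 0" using sub[of i j] by linarith
    thus ?thesis using f0 m(1) by simp
  qed
  \<comment> \<open>Otherwise monotonicity makes all \<open>?d + 1\<close> values up to
    \<open>?d\<close> at least \<open>f 0 / 2\<close>, and their sum exceeds 1 because
    \<open>?d + 1 > 2 / f 0\<close>.\<close>
  have "f ?d \<le> f 0 / 2"
  proof (rule ccontr)
    assume "\<not> f ?d \<le> f 0 / 2"
    hence "f 0 / 2 \<le> f i" if "i \<le> ?d" for i
      using anti[of i "?d - i"] that by simp
    hence "(\<Sum>i\<le>?d. f 0 / 2) \<le> (\<Sum>i\<le>?d. f i)" by (intro sum_mono) auto
    also have "\<dots> \<le> 1"
      unfolding f_def by (rule sum_pmf_inj_le_1) (use s in \<open>auto simp: inj_on_def\<close>)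
    finally have "(real ?d + 1) * f 0 \<le> 2" by (simp add: algebra_simps)
    moreover have "2 / f 0 < real ?d + 1" unfolding half_width_def f0 by linarith
    ultimately show False using f0 m(1) by (simp add: field_simps)
  qed
  \<comment> \<open>\<open>sub\<close> carries the halving from the mode over to an arbitrary
    \<open>i\<close>.\<close>
  hence "f i * f ?d \<le> f i * (f 0 / 2)" using nn by (intro mult_left_mono) auto
  hence "f (i + ?d) * f 0 \<le> (f i / 2) * f 0" using sub[of i ?d] by simp
  thus ?thesis using f0 m(1) by simp
qed

section \<open>Comparison of the mode's probability with the standard deviation\<close>

text \<open>The variance is at most the second moment around the mode, to which each tail
  contributes at most \<open>10 * d^2\<close> by \<open>second_moment_le\<close>; finally 20 is
  rounded up to the square 25.\<close>

lemma sigma_le_half_width: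
  assumes lc: "log_concave p" and m: "0 < pmf p m" "\<And>x. pmf p x \<le> pmf p m"
    and v: "has_variance p (\<sigma>\<^sup>2)" and "0 \<le> \<sigma>"
  shows "\<sigma> \<le> 5 * real (half_width p m)"
proof -
  define d where "d = half_width p m"
  have int2 [simp]: "integrable (measure_pmf p) (\<lambda>x. (real_of_int x)\<^sup>2)"
    and var: "measure_pmf.variance p real_of_int = \<sigma>\<^sup>2"
    using v by (auto simp: has_variance_def)
  have int1 [simp]: "integrable (measure_pmf p) real_of_int"
    by (rule measure_pmf.square_integrable_imp_integrable) simp_all
  define g where "g = (\<lambda>x. (real_of_int x - real_of_int m)\<^sup>2)"
  have g_eq: "g = (\<lambda>x. (real_of_int x)\<^sup>2 - 2 * real_of_int m * real_of_int x + (real_of_int m)\<^sup>2)"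
    by (auto simp: g_def power2_eq_square algebra_simps)
  have intg: "integrable (measure_pmf p) g" unfolding g_eq by simp
  define \<mu> where "\<mu> = measure_pmf.expectation p real_of_int"
  have "measure_pmf.expectation p g = measure_pmf.expectation p (\<lambda>x. (real_of_int x)\<^sup>2)
      - 2 * real_of_int m * \<mu> + (real_of_int m)\<^sup>2"
    unfolding g_eq \<mu>_def by simp
  also have "\<dots> = \<sigma>\<^sup>2 + (\<mu> - real_of_int m)\<^sup>2"
    using measure_pmf.variance_eq[OF int1 int2] var
    unfolding \<mu>_def by (simp add: power2_eq_square algebra_simps)
  finally have "\<sigma>\<^sup>2 \<le> measure_pmf.expectation p g" by simp
  also have "\<dots> \<le> 20 * (real d)\<^sup>2"
  proof (rule LIMSEQ_le_const2)
    \<comment> \<open>Truncation to finite windows, dominated by the integrable \<open>g\<close>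
      itself, reduces the expectation to finite sums over the two tails.\<close>
    show "(\<lambda>N. measure_pmf.expectation p (\<lambda>x. indicator {m - int N<..<m + int N} x * g x))
        \<longlonglongrightarrow> measure_pmf.expectation p g"
    proof (rule integral_dominated_convergence[where w = g])
      show "AE x in p. (\<lambda>N. indicator {m - int N<..<m + int N} x * g x) \<longlonglongrightarrow> g x"
      proof (rule AE_I2, rule tendsto_eventually)
        fix x
        show "\<forall>\<^sub>F N in sequentially. indicator {m - int N<..<m + int N} x * g x = g x"
          using eventually_gt_at_top[of "nat \<bar>x - m\<bar>"]
          by eventually_elim (auto simp: indicator_def)
      qed
    qed (use intg in \<open>auto simp: g_def indicator_def\<close>)
    have half: "(\<Sum>i<N. (real i)\<^sup>2 * pmf p (m + s * int i)) \<le> 10 * (real d)\<^sup>2"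
      if s: "s = 1 \<or> s = -1" for N and s :: int
      unfolding d_def
    proof (rule second_moment_le)
      show "pmf p (m + s * int (i + half_width p m)) \<le> pmf p (m + s * int i) / 2" for i
        by (rule log_concave_halving[OF lc m s])
      show "(\<Sum>i<N. pmf p (m + s * int i)) \<le> 1" for N
        by (rule sum_pmf_inj_le_1) (use s in \<open>auto simp: inj_on_def\<close>)
    qed simp
    have "measure_pmf.expectation p (\<lambda>x. indicator {m - int N<..<m + int N} x * g x) \<le> 20 * (real d)\<^sup>2" for N
    proof -
      \<comment> \<open>Both halves may contain \<open>m\<close>; counting it twice is harmless for
        an upper bound.\<close>
      let ?R = "(\<lambda>i. m + 1 * int i) ` {..<N}" and ?L = "(\<lambda>i. m + (-1) * int i) ` {..<N}"
      have "measure_pmf.expectation p (\<lambda>x. indicator {m - int N<..<m + int N} x * g x)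
          = (\<Sum>x\<in>{m - int N<..<m + int N}. pmf p x *\<^sub>R (indicator {m - int N<..<m + int N} x * g x))"
        by (rule integral_measure_pmf) (auto simp: indicator_def split: if_splits)
      also have "\<dots> = (\<Sum>x\<in>{m - int N<..<m + int N}. pmf p x * g x)"
        by (intro sum.cong) auto
      also have "\<dots> \<le> (\<Sum>x\<in>?R \<union> ?L. pmf p x * g x)"
      proof (rule sum_mono2)
        show "{m - int N<..<m + int N} \<subseteq> ?R \<union> ?L"
        proof
          fix x assume "x \<in> {m - int N<..<m + int N}"
          hence "x = m + 1 * int (nat (x - m)) \<and> nat (x - m) < N \<or>
                 x = m + (-1) * int (nat (m - x)) \<and> nat (m - x) < N" by auto
          thus "x \<in> ?R \<union> ?L" by blast
        qed
      qed (auto simp: g_def)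
      also have "\<dots> \<le> (\<Sum>x\<in>?R. pmf p x * g x) + (\<Sum>x\<in>?L. pmf p x * g x)"
      proof -
        have "0 \<le> (\<Sum>x\<in>?R \<inter> ?L. pmf p x * g x)" by (intro sum_nonneg) (auto simp: g_def)
        thus ?thesis using sum.union_inter[of ?R ?L "\<lambda>x. pmf p x * g x"] by simp
      qed
      also have "(\<Sum>x\<in>?R. pmf p x * g x) = (\<Sum>i<N. (real i)\<^sup>2 * pmf p (m + 1 * int i))"
        by (subst sum.reindex) (auto simp: inj_on_def g_def mult.commute)
      also have "(\<Sum>x\<in>?L. pmf p x * g x) = (\<Sum>i<N. (real i)\<^sup>2 * pmf p (m + (-1) * int i))"
        by (subst sum.reindex) (auto simp: inj_on_def g_def mult.commute)
      finally show ?thesis using half[of 1 N] half[of "-1" N] by simp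
    qed
    thus "\<exists>M. \<forall>N\<ge>M. measure_pmf.expectation p (\<lambda>x. indicator {m - int N<..<m + int N} x * g x) \<le> 20 * (real d)\<^sup>2"
      by blast
  qed
  also have "\<dots> \<le> (5 * real d)\<^sup>2" by (simp add: power_mult_distrib)
  finally show ?thesis unfolding d_def by (rule power2_le_imp_le) simp
qed

text \<open>By Chebyshev, a window of radius \<open>2 * \<sigma> + 1\<close> around the mean carries
  mass at least 3/4. It holds at most \<open>4 * \<sigma> + 3\<close> integers, none more probable
  than \<open>m\<close>.\<close>

lemma mode_ge:
  assumes m: "\<And>x. pmf p x \<le> pmf p m"
    and v: "has_variance p (\<sigma>\<^sup>2)" and "0 \<le> \<sigma>"
  shows "3 \<le> 4 * (4 * \<sigma> + 3) * pmf p m"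
proof -
  have int2: "integrable (measure_pmf p) (\<lambda>x. (real_of_int x)\<^sup>2)"
    and var: "measure_pmf.variance p real_of_int = \<sigma>\<^sup>2"
    using v by (auto simp: has_variance_def)
  define \<mu> where "\<mu> = measure_pmf.expectation p real_of_int"
  \<comment> \<open>The summand 1 keeps the radius positive when
    \<open>\<sigma> = 0\<close>.\<close>
  define a where "a = 2 * \<sigma> + 1"
  have a: "0 < a" using \<open>0 \<le> \<sigma>\<close> by (simp add: a_def)
  define W where "W = {\<lceil>\<mu> - a\<rceil>..\<lfloor>\<mu> + a\<rfloor>}"
  have "measure_pmf.prob p {x. a \<le> \<bar>real_of_int x - \<mu>\<bar>} \<le> \<sigma>\<^sup>2 / a\<^sup>2"
    using measure_pmf.Chebyshev_inequality[of real_of_int p a] int2 a var by (simp add: \<mu>_def)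
  also have "\<dots> \<le> 1 / 4"
  proof -
    have "(2 * \<sigma>)\<^sup>2 \<le> a\<^sup>2" using \<open>0 \<le> \<sigma>\<close> by (intro power_mono) (auto simp: a_def)
    thus ?thesis using a by (simp add: field_simps power2_eq_square)
  qed
  finally have "3 / 4 \<le> 1 - measure_pmf.prob p {x. a \<le> \<bar>real_of_int x - \<mu>\<bar>}" by simp
  also have "\<dots> = measure_pmf.prob p (- {x. a \<le> \<bar>real_of_int x - \<mu>\<bar>})"
    using measure_pmf.prob_compl[of "{x. a \<le> \<bar>real_of_int x - \<mu>\<bar>}" p] by (simp add: Compl_eq_Diff_UNIV)
  also have "\<dots> \<le> measure_pmf.prob p W"
  proof (rule measure_pmf.finite_measure_mono)
    show "- {x. a \<le> \<bar>real_of_int x - \<mu>\<bar>} \<subseteq> W"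
      unfolding W_def by (auto simp: ceiling_le_iff le_floor_iff)
  qed simp
  also have "\<dots> = (\<Sum>x\<in>W. pmf p x)" by (rule measure_measure_pmf_finite) (simp add: W_def)
  also have "\<dots> \<le> real (card W) * pmf p m" using m by (intro sum_bounded_above) auto
  also have "\<dots> \<le> (4 * \<sigma> + 3) * pmf p m"
  proof (rule mult_right_mono)
    show "real (card W) \<le> 4 * \<sigma> + 3"
      using \<open>0 \<le> \<sigma>\<close> unfolding W_def a_def by simp linarith
  qed simp
  finally show ?thesis by (simp add: algebra_simps)
qed

section \<open>Counting the symbols of probability above log n / n\<close>

lemma ln_ge_half:
  assumes "2 \<le> n"
  shows "1 / 2 \<le> ln (real n)"
proof -
  have "1 / real n \<le> 1 / 2" using assms by simp
  moreover have "- ln (real n) \<le> 1 / real n - 1"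
    using ln_le_minus_one[of "1 / real n"] assms by (simp add: ln_div)
  ultimately show ?thesis by linarith
qed

text \<open>Here \<open>k\<close> is a number of halvings that brings any probability down to
  \<open>ln n / n\<close>.\<close>

lemma pow2_ge:
  assumes "2 \<le> n"
  shows "\<exists>k::nat. real k \<le> 6 * ln (real n) \<and> real n \<le> 2 ^ k * ln (real n)"
proof -
  define L where "L = ln (real n)"
  \<comment> \<open>As \<open>ln 2\<close> is at least 1/2, this gives \<open>2^k \<ge> n^2\<close>.
    The spare factor \<open>n \<ge> 2\<close> makes up for \<open>L\<close> possibly being as small
    as 1/2.\<close>
  define k where "k = nat \<lceil>4 * L\<rceil>"
  have ln2: "1 / 2 \<le> ln (2::real)" using ln_ge_half[of 2] by simp
  have L: "1 / 2 \<le> L" unfolding L_def by (rule ln_ge_half[OF assms])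
  have "real k \<le> 6 * L" using L unfolding k_def by linarith
  moreover have "real n \<le> 2 ^ k * L"
  proof -
    have "2 * L = 4 * L * (1 / 2)" by simp
    also have "\<dots> \<le> real k * ln 2" using ln2 L unfolding k_def by (intro mult_mono) linarith+
    also have "\<dots> = ln (2 ^ k)" by (simp add: ln_realpow)
    finally have "ln ((real n)\<^sup>2) \<le> ln (2 ^ k)" using assms by (simp add: L_def ln_realpow)
    hence "(real n)\<^sup>2 \<le> 2 ^ k" using assms by simp
    moreover have "real n * 2 \<le> (real n)\<^sup>2" using assms by (simp add: power2_eq_square)
    ultimately have "real n * 2 * (1 / 2) \<le> 2 ^ k * L" using L by (intro mult_mono) linarith+
    thus ?thesis by simp
  qed
  ultimately show ?thesis unfolding L_def by blast
qed

text \<open>After \<open>k\<close> blocks of \<open>d\<close> steps both tails are below the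
  threshold, so \<open>A\<close> fits into a window of \<open>2 * k * d + 1\<close> symbols. The
  constant is 14 = 2 * 6 + 2, with 6 from \<open>pow2_ge\<close> and 2 from absorbing the
  \<open>+ 1\<close>.\<close>

lemma card_large_pmf:
  assumes lc: "log_concave p" and m: "0 < pmf p m" "\<And>x. pmf p x \<le> pmf p m" and n: "2 \<le> n"
  defines "A \<equiv> {x. ln (real n) / real n < pmf p x}"
  shows "finite A \<and> real (card A) \<le> 14 * ln (real n) * real (half_width p m)"
proof -
  define d where "d = half_width p m"
  obtain k :: nat where k: "real k \<le> 6 * ln (real n)" "real n \<le> 2 ^ k * ln (real n)"
    using pow2_ge[OF n] by blast
  have d: "1 \<le> d" using m(1) unfolding d_def half_width_def by (simp add: Suc_le_eq)
  have small: "pmf p (m + s * int i) \<le> ln (real n) / real n"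
    if s: "s = 1 \<or> s = -1" and i: "k * d \<le> i" for s :: int and i
  proof -
    have "pmf p (m + s * int (k * d + (i - k * d))) \<le> pmf p (m + s * int (i - k * d)) / 2 ^ k"
    proof (rule iterated_halving)
      show "pmf p (m + s * int (j + d)) \<le> pmf p (m + s * int j) / 2" for j
        unfolding d_def by (rule log_concave_halving[OF lc m s])
    qed
    also have "\<dots> \<le> 1 / 2 ^ k" by (intro divide_right_mono pmf_le_1) simp
    also have "\<dots> \<le> ln (real n) / real n" using k(2) n by (simp add: field_simps)
    finally show ?thesis using i by simp
  qed
  have sub: "A \<subseteq> {m - int (k * d)..m + int (k * d)}"
  proof
    fix x assume "x \<in> A"
    hence x: "ln (real n) / real n < pmf p x" by (simp add: A_def)
    have "x \<le> m + int (k * d)"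
    proof (rule ccontr)
      assume "\<not> ?thesis"
      hence "int (k * d) < x - m" by linarith
      hence "k * d \<le> nat (x - m)" "0 \<le> x - m" by linarith+
      thus False using small[of 1 "nat (x - m)"] x by simp
    qed
    moreover have "m - int (k * d) \<le> x"
    proof (rule ccontr)
      assume "\<not> ?thesis"
      hence "int (k * d) < m - x" by linarith
      hence "k * d \<le> nat (m - x)" "0 \<le> m - x" by linarith+
      thus False using small[of "-1" "nat (m - x)"] x by simp
    qed
    ultimately show "x \<in> {m - int (k * d)..m + int (k * d)}" by simp
  qed
  have "real (card A) \<le> real (card {m - int (k * d)..m + int (k * d)})"
    using card_mono[OF _ sub] by (simp only: of_nat_le_iff finite_atLeastAtMost_int)
  also have "\<dots> = 2 * (real k * real d) + 1"
  proof -
    have "card {m - int (k * d)..m + int (k * d)} = 2 * (k * d) + 1"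
      unfolding card_atLeastAtMost_int by linarith
    thus ?thesis by simp
  qed
  also have "\<dots> \<le> 2 * (6 * ln (real n) * real d) + 2 * ln (real n) * real d"
  proof (intro add_mono mult_left_mono mult_right_mono k(1))
    have "2 * (1 / 2) * 1 \<le> 2 * ln (real n) * real d"
      using d ln_ge_half[OF n] by (intro mult_mono) auto
    thus "1 \<le> 2 * ln (real n) * real d" by simp
  qed auto
  finally show ?thesis using finite_subset[OF sub] unfolding d_def by simp
qed

section \<open>Two upper bounds on \<open>H\<^sub>S\<close>\<close>

text \<open>Every family in \<open>ennreal\<close> is summable, with the supremum of its finite
  partial sums as its sum.\<close>

lemma H\<^sub>S_le_finite_sums:
  assumes "\<And>F. finite F \<Longrightarrow> F \<subseteq> {1..} \<Longrightarrow>
    (\<Sum>j\<in>F. min (num_symbols p (prob_interval n j)) (ennreal (real j * ln (real n)))) \<le> b"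
  shows "H\<^sub>S n p \<le> b"
  unfolding H\<^sub>S_def
  by (rule infsum_le_finite_sums[OF nonneg_summable_on_complete assms]) auto

lemma prob_interval_disjoint:
  assumes "j < k" "0 \<le> ln (real n) / real n"
  shows "prob_interval n j \<inter> prob_interval n k = {}"
proof -
  have "(real j)\<^sup>2 * (ln (real n) / real n) \<le> (real k - 1)\<^sup>2 * (ln (real n) / real n)"
    using assms by (intro mult_right_mono power_mono) auto
  thus ?thesis unfolding prob_interval_def by auto
qed

text \<open>Only the term \<open>j = 1\<close>, where infinitely many symbols may lie, uses the cap \<open>j * ln n\<close>.\<close>

lemma H\<^sub>S_le_card:
  assumes n: "2 \<le> n" and A: "A = {x. ln (real n) / real n < pmf p x}" "finite A"
  shows "H\<^sub>S n p \<le> ennreal (ln (real n) + real (card A))"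
proof (rule H\<^sub>S_le_finite_sums)
  fix F :: "nat set" assume F: "finite F" "F \<subseteq> {1..}"
  define L where "L = ln (real n)"
  have L: "0 \<le> L" using n by (simp add: L_def)
  define B where "B = (\<lambda>j. {x. pmf p x \<in> prob_interval n j})"
  let ?t = "\<lambda>j. min (num_symbols p (prob_interval n j)) (ennreal (real j * L))"
  have "sum ?t F \<le> sum ?t (insert 1 (F - {1}))"
    using F(1) by (intro sum_mono2) auto
  also have "\<dots> = ?t 1 + sum ?t (F - {1})" using F(1) by (subst sum.insert) auto
  also have "\<dots> \<le> ennreal L + (\<Sum>j\<in>F - {1}. num_symbols p (prob_interval n j))"
    by (intro add_mono sum_mono) auto
  \<comment> \<open>Since the intervals are disjoint, no symbol is counted twice.\<close>
  also have "(\<Sum>j\<in>F - {1}. num_symbols p (prob_interval n j))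
      = emeasure (count_space UNIV) (\<Union>j\<in>F - {1}. B j)"
    unfolding num_symbols_def B_def[symmetric] B_def[THEN fun_cong, symmetric]
  proof (rule sum_emeasure)
    show "disjoint_family_on B (F - {1})"
      unfolding disjoint_family_on_def
    proof (intro ballI impI)
      fix i j :: nat assume "i \<noteq> j"
      hence "prob_interval n i \<inter> prob_interval n j = {}"
        using prob_interval_disjoint[of i j n] prob_interval_disjoint[of j i n] L n
        by (cases "i < j") (auto simp: L_def)
      thus "B i \<inter> B j = {}" unfolding B_def by blast
    qed
  qed (use F in auto)
  also have "\<dots> \<le> emeasure (count_space UNIV) A"
  proof (rule emeasure_mono)
    show "(\<Union>j\<in>F - {1}. B j) \<subseteq> A"
    proof
      fix x assume "x \<in> (\<Union>j\<in>F - {1}. B j)"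
      then obtain j where j: "j \<in> F" "j \<noteq> 1" "x \<in> B j" by auto
      \<comment> \<open>From \<open>j = 2\<close> on, the lower endpoint of the interval is at least
        \<open>ln n / n\<close>.\<close>
      hence "1 \<le> real j - 1" using F(2) by fastforce
      hence "1 * (L / real n) \<le> (real j - 1)\<^sup>2 * (L / real n)"
        using L by (intro mult_right_mono) auto
      thus "x \<in> A" using j(3) by (auto simp: A B_def prob_interval_def L_def)
    qed
  qed simp
  also have "\<dots> = ennreal (real (card A))" using A(2) by (simp add: ennreal_of_nat_eq_real_of_nat)
  also have "ennreal L + ennreal (real (card A)) = ennreal (L + real (card A))"
    using L by (simp add: ennreal_plus)
  finally show "sum (\<lambda>j. min (num_symbols p (prob_interval n j)) (ennreal (real j * ln (real n)))) F
      \<le> ennreal (ln (real n) + real (card A))"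
    unfolding L_def by (simp add: add_mono)
qed

lemma H\<^sub>S_le_max:
  assumes n: "2 \<le> n" and M: "\<And>x. pmf p x \<le> M"
  shows "H\<^sub>S n p \<le> ennreal (2 * ln (real n) + 2 * (M * real n))"
proof (rule H\<^sub>S_le_finite_sums)
  fix F :: "nat set" assume F: "finite F" "F \<subseteq> {1..}"
  define L where "L = ln (real n)"
  have L: "0 < L" using n by (simp add: L_def)
  have M0: "0 \<le> M" using M[of undefined] pmf_nonneg order_trans by metis
  \<comment> \<open>Chosen so that \<open>r^2 * L / n = M\<close>: once
    \<open>j - 1 \<ge> r\<close>, the interval, open on the left, lies entirely above
    \<open>M\<close> and holds no symbol.\<close>
  define r where "r = sqrt (M * real n / L)"
  have r0: "0 \<le> r" unfolding r_def using M0 L by simp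
  define J where "J = nat \<lfloor>1 + r\<rfloor>"
  let ?t = "\<lambda>j. min (num_symbols p (prob_interval n j)) (ennreal (real j * L))"
  have zero: "?t j = 0" if "J < j" for j
  proof -
    have "r \<le> real j - 1" using that r0 unfolding J_def by linarith
    hence "r\<^sup>2 \<le> (real j - 1)\<^sup>2" using r0 by (rule power_mono)
    hence "r\<^sup>2 * (L / real n) \<le> (real j - 1)\<^sup>2 * (L / real n)"
      using L by (intro mult_right_mono) auto
    moreover have "r\<^sup>2 * (L / real n) = M" unfolding r_def using M0 L n by simp
    ultimately have "{x. pmf p x \<in> prob_interval n j} = {}"
      unfolding prob_interval_def L_def using M by (auto simp: not_less intro: order_trans)
    thus ?thesis by (simp add: num_symbols_def)
  qed
  have "sum ?t F \<le> sum ?t ({..J} \<union> F)" using F(1) by (intro sum_mono2) auto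
  \<comment> \<open>Index 0 drops out because its cap is 0, and indices above \<open>J\<close> by
    \<open>zero\<close>. Below, every remaining cap is bounded by the largest,
    \<open>J * L\<close>.\<close>
  also have "\<dots> = sum ?t {1..J}" using F zero
    by (intro sum.mono_neutral_right) (auto simp: not_le Suc_le_eq)
  also have "\<dots> \<le> (\<Sum>j\<in>{1..J}. ennreal (real J * L))"
    using L by (intro sum_mono min.coboundedI2 ennreal_leI mult_right_mono) auto
  also have "\<dots> = ennreal (real J * (real J * L))"
    using L by (simp add: ennreal_of_nat_eq_real_of_nat ennreal_mult)
  also have "\<dots> \<le> ennreal (2 * L + 2 * (M * real n))"
  proof (rule ennreal_leI)
    have "real J \<le> 1 + r" using r0 unfolding J_def by linarith
    hence "(real J)\<^sup>2 \<le> (1 + r)\<^sup>2" by (intro power_mono) auto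
    also have "\<dots> \<le> 2 + 2 * r\<^sup>2"
      using zero_le_power2[of "1 - r"] by (simp add: power2_eq_square algebra_simps)
    finally have "(real J)\<^sup>2 * L \<le> (2 + 2 * r\<^sup>2) * L" using L by (intro mult_right_mono) auto
    also have "\<dots> = 2 * L + 2 * (r\<^sup>2 * L)" by (simp add: algebra_simps)
    also have "r\<^sup>2 * L = M * real n" unfolding r_def using M0 L by simp
    finally show "real J * (real J * L) \<le> 2 * L + 2 * (M * real n)"
      by (simp add: power2_eq_square mult.assoc)
  qed
  finally show "sum (\<lambda>j. min (num_symbols p (prob_interval n j)) (ennreal (real j * ln (real n)))) F
      \<le> ennreal (2 * ln (real n) + 2 * (M * real n))"
    unfolding L_def .
qed

section \<open>The bounds by \<sigma> and by n/\<sigma> combined\<close>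

theorem theorem13:
  "\<exists>C::real. C > 0 \<and>
     (\<forall>(n::nat) (p::int pmf) (\<sigma>::real).
        n \<ge> 2 \<longrightarrow> \<sigma> \<ge> 0 \<longrightarrow> log_concave p \<longrightarrow> has_variance p (\<sigma>\<^sup>2) \<longrightarrow>
        H\<^sub>S n p \<le> ennreal (C * ln (real n)) * (1 + min (ennreal \<sigma>) (of_nat n / ennreal \<sigma>)))"
proof (intro exI[of _ "225::real"] conjI allI impI)
  fix n :: nat and p :: "int pmf" and \<sigma> :: real
  assume n: "2 \<le> n" and \<sigma>: "0 \<le> \<sigma>" and lc: "log_concave p" and v: "has_variance p (\<sigma>\<^sup>2)"
  define L where "L = ln (real n)"
  have L: "1 / 2 \<le> L" unfolding L_def by (rule ln_ge_half[OF n])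
  obtain m where m: "0 < pmf p m" "\<And>x. pmf p x \<le> pmf p m" using pmf_mode[of p] by blast
  define M where "M = pmf p m"
  define d where "d = real (half_width p m)"
  have M: "0 < M" and dM: "d * M \<le> 3" and \<sigma>d: "\<sigma> \<le> 5 * d" and M\<sigma>: "3 \<le> 4 * (4 * \<sigma> + 3) * M"
    unfolding M_def d_def
    using m(1) half_width_le[OF m(1)] sigma_le_half_width[OF lc m v \<sigma>] mode_ge[OF m(2) v \<sigma>] by auto
  have d\<sigma>: "d \<le> 16 * (1 + \<sigma>)"
  proof -
    have "d * M \<le> 4 * (4 * \<sigma> + 3) * M" using dM M\<sigma> by linarith
    hence "d \<le> 4 * (4 * \<sigma> + 3)" using M by simp
    thus ?thesis using \<sigma> by simp
  qed
  define A where "A = {x. ln (real n) / real n < pmf p x}"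
  have A: "finite A" "real (card A) \<le> 14 * L * d"
    using card_large_pmf[OF lc m n] unfolding A_def L_def d_def by auto
  \<comment> \<open>This fixes the constant 225 = 1 + 14 * 16; the bound by
    \<open>n / \<sigma>\<close> needs only 60.\<close>
  have "L + real (card A) \<le> L * (1 + \<sigma>) + 14 * L * (16 * (1 + \<sigma>))"
  proof (rule add_mono)
    show "L \<le> L * (1 + \<sigma>)" using \<sigma> L by simp
    show "real (card A) \<le> 14 * L * (16 * (1 + \<sigma>))"
      using A(2) mult_left_mono[OF d\<sigma>, of "14 * L"] L by linarith
  qed
  also have "\<dots> = 225 * L * (1 + \<sigma>)" by (simp add: algebra_simps)
  finally have "H\<^sub>S n p \<le> ennreal (225 * L * (1 + \<sigma>))"
    using H\<^sub>S_le_card[OF n A_def A(1)] ennreal_leI order_trans unfolding L_def by blast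
  also have "\<dots> = ennreal (225 * L) * (1 + ennreal \<sigma>)"
    using \<sigma> L by (simp add: ennreal_mult ennreal_plus)
  finally have 1: "H\<^sub>S n p \<le> ennreal (225 * L) * (1 + ennreal \<sigma>)" .
  have 2: "H\<^sub>S n p \<le> ennreal (225 * L) * (1 + of_nat n / ennreal \<sigma>)" if "0 < \<sigma>"
  proof -
    have "\<sigma> * M \<le> 15" using mult_right_mono[OF \<sigma>d, of M] M dM by linarith
    hence "M \<le> 15 / \<sigma>" using that by (simp add: field_simps)
    hence "M * real n \<le> 15 / \<sigma> * real n" by (intro mult_right_mono) auto
    hence Mn: "M * real n \<le> 15 * (real n / \<sigma>)" by simp
    \<comment> \<open>The bound on \<open>M * n\<close> carries no logarithm;
      \<open>L \<ge> 1/2\<close> supplies one at the cost of a factor 2.\<close>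
    have "1 / 2 * (real n / \<sigma>) \<le> L * (real n / \<sigma>)" using L that by (intro mult_right_mono) auto
    hence "2 * L + 2 * (M * real n) \<le> 2 * L + 60 * (L * (real n / \<sigma>))" using Mn by linarith
    also have "\<dots> \<le> 225 * L * (1 + real n / \<sigma>)"
    proof -
      have "0 \<le> L * (real n / \<sigma>)" using L that by simp
      thus ?thesis using L unfolding distrib_left by linarith
    qed
    finally have "H\<^sub>S n p \<le> ennreal (225 * L * (1 + real n / \<sigma>))"
      using H\<^sub>S_le_max[OF n m(2)] ennreal_leI order_trans unfolding L_def M_def by blast
    also have "\<dots> = ennreal (225 * L) * (1 + ennreal (real n / \<sigma>))"
      using that L by (simp add: ennreal_mult ennreal_plus)
    also have "ennreal (real n / \<sigma>) = of_nat n / ennreal \<sigma>"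
      using that by (simp add: divide_ennreal[symmetric] ennreal_of_nat_eq_real_of_nat)
    finally show ?thesis .
  qed
  \<comment> \<open>For \<open>\<sigma> = 0\<close> the minimum is 0, so the first bound alone
    suffices.\<close>
  show "H\<^sub>S n p \<le> ennreal (225 * ln (real n)) * (1 + min (ennreal \<sigma>) (of_nat n / ennreal \<sigma>))"
    unfolding L_def[symmetric] using 1 2 \<sigma> by (cases "\<sigma> = 0") (auto simp: min_def)
qed simp
end
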